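(* Let $\theta>0$ be real, and consider the two-step recurrence $$U_n=T_1(w_0,z_0,z_1,z_2)\,U_{n-1}+T_0(w_0,z_0,z_1,z_2)\,U_{n-2},\qquad (\dagger)$$ with coefficients $T_0,T_1$ (depending on $\theta$) and the notion of stability defined in the context. Consider the condition $$|z_0|+|w_0|\le 2\sqrt{\operatorname{Re} z_1\,\operatorname{Re} z_2}\quad\text{and}\quad \operatorname{Re} z_1\le-\tfrac12|w_0|,\ \operatorname{Re} z_2\le-\tfrac12|w_0|. \qquad ( * )$$ (a) If $\theta\ge\frac13$, then $(\dagger)$ is stable for all $w_0,z_0,z_1,z_2\in\mathbb{R}$ satisfying $( * )$ and $w_0\ge 0$. (b) If $(\dagger)$ is stable for all $w_0,z_0,z_1,z_2\in\mathbb{R}$ satisfying $( * )$, then $\theta\ge(9+\sqrt{33})/16$.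
   Context: $\operatorname{Re}$ denotes the real part. For a real parameter $\theta>0$ and complex numbers $w_0,z_0,z_1,z_2$, put $$z=w_0+z_0+z_1+z_2,\qquad p=(1-\theta z_1)(1-\theta z_2),$$ $$T_1(w_0,z_0,z_1,z_2)=1+\left(z+\tfrac12 w_0\right)\left(\frac1p+\theta\frac{z_0}{p^2}+\left(\tfrac12-\theta\right)\frac{z_0+z_1+z_2}{p^2}\right),$$ $$T_0(w_0,z_0,z_1,z_2)=-\tfrac12 w_0\left(\frac1p+\theta\frac{z_0}{p^2}+\left(\tfrac12-\theta\right)\frac{z_0+z_1+z_2}{p^2}\right).$$ For a given point $(w_0,z_0,z_1,z_2)$ the recurrence is called stable if the companion matrix $\begin{pmatrix}T_1&T_0\\1&0\end{pmatrix}$ (evaluated at that point) is power-bounded; equivalently, the root condition holds: both roots $\zeta$ of $P(\zeta)=\zeta^2-T_1\zeta-T_0$ have modulus at most one, and those with modulus equal to one are simple. The recurrence arises from applying the third adaptation of the Modified Craig--Sneyd scheme with parameter $\theta$ (integral term treated in a two-step Adams--Bashforth fashion) to the scalar test equation $\dot U=(\lambda_0+\mu_0+\mu_1+\mu_2)U$ with step size $\Delta t$, where $w_0=\lambda_0\Delta t$ and $z_j=\mu_j\Delta t$ for $j=0,1,2$. *)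

theory Defs
  imports "HOL-Analysis.Analysis"
begin

definition p_coeff :: "real \<Rightarrow> complex \<Rightarrow> complex \<Rightarrow> complex" where
  "p_coeff \<theta> z1 z2 = (1 - of_real \<theta> * z1) * (1 - of_real \<theta> * z2)"

definition T1 :: "real \<Rightarrow> complex \<Rightarrow> complex \<Rightarrow> complex \<Rightarrow> complex \<Rightarrow> complex" where
  "T1 \<theta> w0 z0 z1 z2 =
     (let z = w0 + z0 + z1 + z2; p = p_coeff \<theta> z1 z2
      in 1 + (z + 1/2 * w0) *
           (1 / p + of_real \<theta> * (z0 / p^2) + (1/2 - of_real \<theta>) * ((z0 + z1 + z2) / p^2)))"

definition T0 :: "real \<Rightarrow> complex \<Rightarrow> complex \<Rightarrow> complex \<Rightarrow> complex \<Rightarrow> complex" where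
  "T0 \<theta> w0 z0 z1 z2 =
     (let p = p_coeff \<theta> z1 z2
      in - (1/2) * w0 *
           (1 / p + of_real \<theta> * (z0 / p^2) + (1/2 - of_real \<theta>) * ((z0 + z1 + z2) / p^2)))"

definition companion_matrix :: "complex \<Rightarrow> complex \<Rightarrow> complex^2^2" where
  "companion_matrix t1 t0 = vector [vector [t1, t0], vector [1, 0]]"

text \<open>The operations \<open>*\<close> and \<open>1\<close> on vectors are componentwise, so \<open>A ^ n\<close> would not
  be the power of a matrix; powers are therefore taken with respect to \<open>**\<close>.\<close>

primrec matrix_power :: "complex^'n^'n \<Rightarrow> nat \<Rightarrow> complex^'n^'n" where
  "matrix_power A 0 = mat 1"
| "matrix_power A (Suc n) = A ** matrix_power A n"

definition power_bounded :: "complex^'n^'n \<Rightarrow> bool" where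
  "power_bounded A \<longleftrightarrow> (\<exists>C. \<forall>n. norm (matrix_power A n) \<le> C)"

definition recurrence_stable :: "real \<Rightarrow> complex \<Rightarrow> complex \<Rightarrow> complex \<Rightarrow> complex \<Rightarrow> bool" where
  "recurrence_stable \<theta> w0 z0 z1 z2 \<longleftrightarrow>
     power_bounded (companion_matrix (T1 \<theta> w0 z0 z1 z2) (T0 \<theta> w0 z0 z1 z2))"

definition condition_star :: "complex \<Rightarrow> complex \<Rightarrow> complex \<Rightarrow> complex \<Rightarrow> bool" where
  "condition_star w0 z0 z1 z2 \<longleftrightarrow>
     norm z0 + norm w0 \<le> 2 * sqrt (Re z1 * Re z2) \<and>
     Re z1 \<le> - (1/2) * norm w0 \<and> Re z2 \<le> - (1/2) * norm w0"

end

theory Submission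
  imports Defs
begin

text \<open>With \<open>a = -z\<^sub>1\<close> and \<open>b = -z\<^sub>2\<close> the bracket in \<open>T\<^sub>1\<close> and \<open>T\<^sub>0\<close> equals \<open>Q = N / p\<^sup>2\<close> with
  \<open>N = 1 + (2\<theta> - 1/2)(a + b) + \<theta>\<^sup>2 a b + z\<^sub>0 / 2\<close>, and the root condition becomes
  \<open>P(1) = -z Q \<ge> 0\<close>, \<open>P(-1) = 2 + (z + w\<^sub>0) Q \<ge> 0\<close> and a bound on \<open>P(0) = w\<^sub>0 Q / 2\<close>.
  For \<open>\<theta> \<ge> 1/3\<close> one has \<open>N \<ge> (1 - \<surd>(a b) / 3)\<^sup>2\<close>, and for \<open>w\<^sub>0 \<ge> 0\<close> the other two conditions are
  applications of the inequality of arithmetic and geometric means to \<open>(a + b - z\<^sub>0) N\<close> and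
  \<open>w\<^sub>0 N\<close>. Conversely, \<open>z\<^sub>1 = z\<^sub>2 = -1/\<theta>\<close> with \<open>w\<^sub>0 = 0\<close>, \<open>z\<^sub>0 = -2/\<theta>\<close> gives \<open>P(1) < 0\<close> if
  \<open>\<theta> < 1/3\<close>, and with \<open>w\<^sub>0 = -2/\<theta>\<close>, \<open>z\<^sub>0 = 0\<close> it gives \<open>P(-1) < 0\<close> if \<open>16\<theta>\<^sup>2 - 18\<theta> + 3 < 0\<close>.\<close>

section \<open>Power-boundedness of 2x2 companion matrices\<close>

lemma norm_matrix_le_sum:
  fixes A :: "complex^'n^'m"
  shows "norm A \<le> (\<Sum>i\<in>UNIV. \<Sum>j\<in>UNIV. norm (A $ i $ j))"
proof -
  have "norm A \<le> (\<Sum>i\<in>UNIV. norm (A $ i))"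
    unfolding norm_vec_def[of A] by (rule L2_set_le_sum) simp
  also have "\<dots> \<le> (\<Sum>i\<in>UNIV. \<Sum>j\<in>UNIV. norm (A $ i $ j))"
    by (rule sum_mono) (simp add: norm_vec_def L2_set_le_sum)
  finally show ?thesis .
qed

lemma matrix_power_companion_Suc:
  fixes t1 t0 :: complex
  defines "A \<equiv> companion_matrix t1 t0"
  shows "matrix_power A (Suc n) $ 1 $ j = t1 * matrix_power A n $ 1 $ j + t0 * matrix_power A n $ 2 $ j"
    and "matrix_power A (Suc n) $ 2 $ j = matrix_power A n $ 1 $ j"
  by (simp_all add: A_def companion_matrix_def matrix_matrix_mult_def sum_2)

lemma two_term_recurrence_bounded:
  fixes x y :: "nat \<Rightarrow> complex" and r s :: complex
  assumes x: "\<And>n. x (Suc n) = (r + s) * x n - r * s * y n" and y: "\<And>n. y (Suc n) = x n"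
    and r: "norm r < 1" and s: "norm s \<le> 1"
  shows "\<exists>K. \<forall>n. norm (x n) \<le> K \<and> norm (y n) \<le> K"
proof -
  define d where "d n = x n - s * y n" for n
  define V where "V n = norm (y n) + norm (d n) / (1 - norm r)" for n
  have d_Suc: "d (Suc n) = r * d n" for n
    by (simp add: d_def x y algebra_simps)
  have y_Suc: "y (Suc n) = d n + s * y n" for n
    by (simp add: d_def y)
  have V_Suc: "V (Suc n) \<le> V n" for n
  proof -
    have "norm (y (Suc n)) \<le> norm (d n) + norm (s * y n)"
      unfolding y_Suc by (rule norm_triangle_ineq)
    also have "norm (s * y n) \<le> norm (y n)"
      using s by (simp add: norm_mult mult_left_le_one_le)
    finally have "norm (y (Suc n)) \<le> norm (d n) + norm (y n)" by simp
    moreover have "norm (d n) + norm r * norm (d n) / (1 - norm r) = norm (d n) / (1 - norm r)"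
      using r by (simp add: field_simps)
    ultimately show ?thesis
      by (simp add: V_def d_Suc norm_mult)
  qed
  have V_le: "V n \<le> V 0" for n
    using V_Suc by (induction n) (auto intro: order_trans)
  have y_le: "norm (y n) \<le> V 0" for n
  proof -
    have "norm (y n) \<le> V n" using r by (simp add: V_def)
    then show ?thesis using V_le by (rule order_trans)
  qed
  moreover have "norm (x n) \<le> V 0" for n
    using y_le[of "Suc n"] by (simp add: y)
  ultimately show ?thesis by blast
qed

lemma power_bounded_companion_roots:
  fixes r s :: complex
  assumes "norm r < 1" "norm s \<le> 1"
  shows "power_bounded (companion_matrix (r + s) (- (r * s)))"
proof -
  define A where "A = companion_matrix (r + s) (- (r * s))"
  have "\<exists>K. \<forall>n. norm (matrix_power A n $ 1 $ j) \<le> K \<and> norm (matrix_power A n $ 2 $ j) \<le> K" for j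
    by (rule two_term_recurrence_bounded[OF _ _ assms])
       (simp_all add: A_def matrix_power_companion_Suc del: matrix_power.simps)
  then obtain K where K: "norm (matrix_power A n $ 1 $ j) \<le> K j" "norm (matrix_power A n $ 2 $ j) \<le> K j"
    for n j by metis
  have "norm (matrix_power A n) \<le> 2 * K 1 + 2 * K 2" for n
    using norm_matrix_le_sum[of "matrix_power A n"] K[of n 1] K[of n 2] by (simp add: sum_2)
  then show ?thesis unfolding power_bounded_def A_def by blast
qed

text \<open>For P(x) = x^2 - t x + q the hypotheses say |P(0)| < 1, P(1) \<ge> 0 and P(-1) \<ge> 0.
  The strict bound on the product \<open>q\<close> of the roots keeps them from both lying on the
  unit circle.\<close>

lemma power_bounded_companion_real:
  fixes t q :: real
  assumes q: "\<bar>q\<bar> < 1" and t: "\<bar>t\<bar> \<le> 1 + q"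
  shows "power_bounded (companion_matrix (of_real t) (of_real (- q)))"
proof (cases "4 * q \<le> t\<^sup>2")
  case True
  define D where "D = sqrt (t\<^sup>2 - 4 * q)"
  define r where "r = (t + D) / 2"
  define s where "s = (t - D) / 2"
  have D: "D\<^sup>2 = t\<^sup>2 - 4 * q" using True by (simp add: D_def)
  have sum: "r + s = t" by (simp add: r_def s_def field_simps)
  have prod: "r * s = q" using D by (simp add: r_def s_def field_simps power2_eq_square)
  have minus: "(1 - r) * (1 - s) \<ge> 0" and plus: "(1 + r) * (1 + s) \<ge> 0"
    using t sum prod by (simp_all add: algebra_simps)
  \<comment> \<open>If one real root lies beyond 1 or -1, the sign of P there pushes the other root
    to the same side, so the product is at least 1.\<close>
  have bound: "\<bar>u\<bar> \<le> 1"
    if "(1 - u) * (1 - v) \<ge> 0" "(1 + u) * (1 + v) \<ge> 0" "u * v = q" for u v :: real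
  proof (rule ccontr)
    assume "\<not> \<bar>u\<bar> \<le> 1"
    then consider "u > 1" | "u < -1" by linarith
    then have "u * v \<ge> 1"
    proof cases
      case 1
      then have "v \<ge> 1" using that(1) by (simp add: zero_le_mult_iff)
      then show ?thesis using 1 mult_mono[of 1 u 1 v] by simp
    next
      case 2
      then have "v \<le> -1" using that(2) by (simp add: zero_le_mult_iff)
      then show ?thesis using 2 mult_mono[of 1 "-u" 1 "-v"] by simp
    qed
    then show False using q that(3) by simp
  qed
  have r1: "\<bar>r\<bar> \<le> 1" using bound[OF minus plus prod] .
  have s1: "\<bar>s\<bar> \<le> 1" using bound[of s r] minus plus prod by (simp add: mult.commute)
  have "\<not> (\<bar>r\<bar> = 1 \<and> \<bar>s\<bar> = 1)" using q unfolding prod[symmetric] abs_mult by auto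
  then consider "\<bar>r\<bar> < 1" | "\<bar>s\<bar> < 1" using r1 s1 by linarith
  then have "power_bounded (companion_matrix (of_real (r + s)) (of_real (- (r * s))))"
  proof cases
    case 1
    then show ?thesis
      using power_bounded_companion_roots[of "of_real r" "of_real s"] s1 by simp
  next
    case 2
    then show ?thesis
      using power_bounded_companion_roots[of "of_real s" "of_real r"] r1 by (simp add: ac_simps)
  qed
  then show ?thesis by (simp only: sum prod)
next
  case False
  \<comment> \<open>The roots are now conjugate, with squared modulus \<open>q\<close>.\<close>
  define r where "r = Complex (t / 2) (sqrt (q - t\<^sup>2 / 4))"
  have "cmod r = sqrt q" using False by (simp add: r_def cmod_def power_divide)
  moreover have "sqrt q < 1" using q by simp
  ultimately have "power_bounded (companion_matrix (r + cnj r) (- (r * cnj r)))"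
    using power_bounded_companion_roots[of r "cnj r"] by simp
  moreover have "r + cnj r = of_real t" by (simp add: r_def complex_add_cnj)
  moreover have "r * cnj r = of_real q"
    using False by (simp add: complex_mult_cnj r_def power_divide)
  ultimately show ?thesis by simp
qed

text \<open>The vector (\<zeta>, 1) is an eigenvector for \<zeta>, so bounded powers of the matrix
  rule out geometric growth of \<open>\<zeta> ^ n\<close>.\<close>

lemma companion_root_norm_le_1:
  fixes t1 t0 \<zeta> :: complex
  assumes pb: "power_bounded (companion_matrix t1 t0)" and root: "\<zeta>\<^sup>2 = t1 * \<zeta> + t0"
  shows "norm \<zeta> \<le> 1"
proof (rule ccontr)
  assume "\<not> norm \<zeta> \<le> 1"
  define A where "A = companion_matrix t1 t0"
  obtain C where C: "norm (matrix_power A n) \<le> C" for n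
    using pb unfolding power_bounded_def A_def by blast
  have eig: "matrix_power A n $ 1 $ 1 * \<zeta> + matrix_power A n $ 1 $ 2 = \<zeta> ^ Suc n \<and>
             matrix_power A n $ 2 $ 1 * \<zeta> + matrix_power A n $ 2 $ 2 = \<zeta> ^ n" for n
  proof (induction n)
    case 0
    then show ?case by (simp add: mat_def)
  next
    case (Suc n)
    let ?M = "matrix_power A n"
    have "(t1 * ?M $ 1 $ 1 + t0 * ?M $ 2 $ 1) * \<zeta> + (t1 * ?M $ 1 $ 2 + t0 * ?M $ 2 $ 2)
        = t1 * (?M $ 1 $ 1 * \<zeta> + ?M $ 1 $ 2) + t0 * (?M $ 2 $ 1 * \<zeta> + ?M $ 2 $ 2)"
      by (simp add: algebra_simps)
    also have "\<dots> = (t1 * \<zeta> + t0) * \<zeta> ^ n"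
      unfolding Suc.IH[THEN conjunct1] Suc.IH[THEN conjunct2] by (simp add: algebra_simps)
    also have "\<dots> = \<zeta> ^ Suc (Suc n)"
      unfolding root[symmetric] by (simp add: power2_eq_square)
    finally show ?case
      using Suc.IH unfolding A_def matrix_power_companion_Suc by blast
  qed
  have entry: "norm (matrix_power A n $ i $ j) \<le> C" for n i j
    using Finite_Cartesian_Product.norm_nth_le[of "matrix_power A n $ i" j]
      Finite_Cartesian_Product.norm_nth_le[of "matrix_power A n" i] C[of n] by linarith
  have "norm \<zeta> ^ n \<le> C * norm \<zeta> + C" for n
  proof -
    have "norm \<zeta> ^ n = norm (matrix_power A n $ 2 $ 1 * \<zeta> + matrix_power A n $ 2 $ 2)"
      using eig[of n] by (simp add: norm_power)
    also have "\<dots> \<le> norm (matrix_power A n $ 2 $ 1) * norm \<zeta> + norm (matrix_power A n $ 2 $ 2)"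
      by (metis norm_mult norm_triangle_ineq)
    also have "\<dots> \<le> C * norm \<zeta> + C"
      by (intro add_mono mult_right_mono entry) simp
    finally show ?thesis .
  qed
  moreover obtain n where "C * norm \<zeta> + C < norm \<zeta> ^ n"
    using real_arch_pow[of "norm \<zeta>"] \<open>\<not> norm \<zeta> \<le> 1\<close> by (meson not_le)
  ultimately show False by (meson not_le)
qed

lemma power_bounded_companion_realD:
  fixes t q :: real
  assumes pb: "power_bounded (companion_matrix (of_real t) (of_real (- q)))"
  shows "\<bar>t\<bar> \<le> 1 + q"
proof (rule ccontr)
  assume neg: "\<not> \<bar>t\<bar> \<le> 1 + q"
  define D where "D = sqrt (t\<^sup>2 - 4 * q)"
  \<comment> \<open>After expansion this is exactly \<open>\<bar>t\<bar> > 1 + q\<close>. It makes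
    the discriminant positive, and the root \<open>r\<close> whose two terms have equal sign has
    modulus \<open>(\<bar>t\<bar> + D) / 2 > 1\<close>.\<close>
  have "(\<bar>t\<bar> - 2)\<^sup>2 < t\<^sup>2 - 4 * q"
    using neg by (simp add: power2_eq_square algebra_simps)
  then have D2: "D\<^sup>2 = t\<^sup>2 - 4 * q" and "\<bar>\<bar>t\<bar> - 2\<bar> < D"
    unfolding D_def
    by (smt (verit) real_sqrt_pow2 zero_le_power2, simp add: real_less_rsqrt)
  then have big: "\<bar>t\<bar> + D > 2" and "D \<ge> 0" by linarith+
  define r where "r = (if t \<ge> 0 then t + D else t - D) / 2"
  have "r\<^sup>2 = t * r - q"
    using D2 by (simp add: r_def power2_eq_square field_simps)
  then have "(of_real r :: complex)\<^sup>2 = of_real t * of_real r + of_real (- q)"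
    by (metis diff_conv_add_uminus of_real_add of_real_mult of_real_power)
  from companion_root_norm_le_1[OF pb this] have "\<bar>r\<bar> \<le> 1" by simp
  then show False using big by (auto simp: r_def split: if_splits)
qed

section \<open>Reduction to real coefficients\<close>

definition mcs_numerator :: "real \<Rightarrow> real \<Rightarrow> real \<Rightarrow> real \<Rightarrow> real" where
  "mcs_numerator \<theta> z0 a b = 1 + (2 * \<theta> - 1/2) * (a + b) + \<theta>\<^sup>2 * (a * b) + z0 / 2"

definition mcs_factor :: "real \<Rightarrow> real \<Rightarrow> real \<Rightarrow> real \<Rightarrow> real" where
  "mcs_factor \<theta> z0 a b = mcs_numerator \<theta> z0 a b / ((1 + \<theta> * a) * (1 + \<theta> * b))\<^sup>2"

lemma T_bracket_eq_mcs_factor: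
  fixes \<theta> a b z0 :: real
  assumes "1 + \<theta> * a \<noteq> 0" "1 + \<theta> * b \<noteq> 0"
  defines "p \<equiv> (1 + \<theta> * a) * (1 + \<theta> * b)"
  shows "1 / p + \<theta> * (z0 / p\<^sup>2) + (1/2 - \<theta>) * ((z0 - a - b) / p\<^sup>2) = mcs_factor \<theta> z0 a b"
proof -
  have "p \<noteq> 0" using assms by simp
  then have "1 / p + \<theta> * (z0 / p\<^sup>2) + (1/2 - \<theta>) * ((z0 - a - b) / p\<^sup>2)
      = (p + \<theta> * z0 + (1/2 - \<theta>) * (z0 - a - b)) / p\<^sup>2"
    by (simp add: add_divide_distrib power2_eq_square)
  also have "p + \<theta> * z0 + (1/2 - \<theta>) * (z0 - a - b) = mcs_numerator \<theta> z0 a b"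
    by (simp add: mcs_numerator_def p_def field_simps power2_eq_square)
  finally show ?thesis by (simp add: mcs_factor_def p_def)
qed

lemma T_of_real:
  fixes \<theta> w z0 a b :: real
  assumes "1 + \<theta> * a \<noteq> 0" "1 + \<theta> * b \<noteq> 0"
  defines "Q \<equiv> mcs_factor \<theta> z0 a b"
  shows "T1 \<theta> (of_real w) (of_real z0) (of_real (- a)) (of_real (- b))
           = of_real (1 + (w + z0 - a - b + w / 2) * Q)"
    and "T0 \<theta> (of_real w) (of_real z0) (of_real (- a)) (of_real (- b)) = of_real (- (w / 2 * Q))"
  unfolding Q_def T_bracket_eq_mcs_factor[OF assms(1,2), symmetric] T1_def T0_def p_coeff_def Let_def
  by simp_all

lemma recurrence_stable_real:
  fixes \<theta> w z0 a b :: real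
  assumes "\<theta> > 0" "a \<ge> 0" "b \<ge> 0"
  defines "Q \<equiv> mcs_factor \<theta> z0 a b" and "z \<equiv> w + z0 - a - b"
  shows "recurrence_stable \<theta> (of_real w) (of_real z0) (of_real (- a)) (of_real (- b)) \<longleftrightarrow>
         power_bounded (companion_matrix (of_real (1 + (z + w / 2) * Q)) (of_real (- (w / 2 * Q))))"
proof -
  have "1 + \<theta> * a > 0" "1 + \<theta> * b > 0" using assms by (simp_all add: add_pos_nonneg)
  then show ?thesis
    using T_of_real[of \<theta> a b w z0] unfolding recurrence_stable_def Q_def z_def by simp
qed

lemma condition_star_real:
  fixes w z0 a b :: real
  shows "condition_star (of_real w) (of_real z0) (of_real (- a)) (of_real (- b)) \<longleftrightarrow>
         \<bar>z0\<bar> + \<bar>w\<bar> \<le> 2 * sqrt (a * b) \<and> \<bar>w\<bar> \<le> 2 * a \<and> \<bar>w\<bar> \<le> 2 * b"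
  by (auto simp: condition_star_def)

section \<open>Sufficiency of \<theta> \<ge> 1/3 for nonnegative \<open>w\<close>\<close>

lemma mcs_numerator_nonneg:
  fixes \<theta> a b z0 :: real
  assumes \<theta>: "\<theta> \<ge> 1/3" and ab: "a \<ge> 0" "b \<ge> 0" and z0: "\<bar>z0\<bar> \<le> 2 * sqrt (a * b)"
  shows "mcs_numerator \<theta> z0 a b \<ge> 0"
proof -
  define s where "s = sqrt (a * b)"
  have s2: "s\<^sup>2 = a * b" using ab by (simp add: s_def)
  have am_gm: "2 * s \<le> a + b" using arith_geo_mean_sqrt[OF ab] by (simp add: s_def)
  \<comment> \<open>1/6 is the value of \<open>2 * \<theta> - 1/2\<close> at \<theta> = 1/3.\<close>
  have "(1/6) * (2 * s) \<le> (2 * \<theta> - 1/2) * (a + b)"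
    using \<theta> ab am_gm by (intro mult_mono) (auto simp: s_def)
  moreover have "(1/3)\<^sup>2 * s\<^sup>2 \<le> \<theta>\<^sup>2 * s\<^sup>2"
    using \<theta> by (intro mult_right_mono power_mono) auto
  moreover have "0 \<le> 1 - (2/3) * s + (1/3)\<^sup>2 * s\<^sup>2"
    using zero_le_power2[of "1 - s / 3"] by (simp add: power2_eq_square algebra_simps)
  ultimately show ?thesis
    using z0[folded s_def] unfolding mcs_numerator_def s2 by linarith
qed

lemma mult_twice_diff_le_square:
  fixes x y :: real
  shows "x * (2 * y - x) \<le> y\<^sup>2"
proof -
  have "0 \<le> (x - y)\<^sup>2" by simp
  then show ?thesis by (simp add: power2_eq_square algebra_simps)
qed

lemma recurrence_stable_if_ge_third:
  fixes \<theta> w z0 a b :: real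
  assumes \<theta>: "\<theta> \<ge> 1/3" and w: "0 \<le> w" and a: "w \<le> 2 * a" and b: "w \<le> 2 * b"
    and zw: "\<bar>z0\<bar> + w \<le> 2 * sqrt (a * b)"
  shows "recurrence_stable \<theta> (of_real w) (of_real z0) (of_real (- a)) (of_real (- b))"
proof -
  have ab: "a \<ge> 0" "b \<ge> 0" using w a b by auto
  define s where "s = sqrt (a * b)"
  define p where "p = (1 + \<theta> * a) * (1 + \<theta> * b)"
  define N where "N = mcs_numerator \<theta> z0 a b"
  define Q where "Q = mcs_factor \<theta> z0 a b"
  define z where "z = w + z0 - a - b"
  have zws: "\<bar>z0\<bar> + w \<le> 2 * s" using zw by (simp add: s_def)
  have am_gm: "2 * s \<le> a + b" using arith_geo_mean_sqrt[OF ab] by (simp add: s_def)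
  have \<theta>ab: "\<theta> * a \<ge> 0" "\<theta> * b \<ge> 0" using \<theta> ab by simp_all
  have prod: "\<theta>\<^sup>2 * (a * b) \<ge> 0" using ab by simp
  have p_eq: "p = 1 + \<theta> * a + \<theta> * b + \<theta>\<^sup>2 * (a * b)"
    by (simp add: p_def power2_eq_square algebra_simps)
  have N_eq: "2 * N = 2 + 4 * (\<theta> * a) + 4 * (\<theta> * b) - a - b + 2 * (\<theta>\<^sup>2 * (a * b)) + z0"
    by (simp add: N_def mcs_numerator_def algebra_simps)
  have p: "p > 0" using p_eq \<theta>ab prod by linarith
  have N: "N \<ge> 0"
    unfolding N_def using \<theta> ab zw w by (intro mcs_numerator_nonneg) auto
  have Q_eq: "Q = N / p\<^sup>2" by (simp add: Q_def mcs_factor_def N_def p_def)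
  have Q: "Q \<ge> 0" using N by (simp add: Q_eq)
  have z: "z \<le> 0" using zws am_gm unfolding z_def by linarith
  have wQ: "w * Q < 2"
  proof -
    \<comment> \<open>The factors \<open>w\<close> and \<open>2 * N\<close> have mean
      \<open>N + w / 2\<close>.\<close>
    have "w * (2 * N) \<le> w * (2 * (N + w / 2) - w)" by simp
    also have "\<dots> \<le> (N + w / 2)\<^sup>2" by (rule mult_twice_diff_le_square)
    also have "\<dots> < (2 * p)\<^sup>2"
    proof (rule power_strict_mono)
      \<comment> \<open>The terms in \<theta> a and \<theta> b cancel:
        \<open>4 * p - 2 * N - w\<close> equals
        \<open>2 + 2 * \<theta>\<^sup>2 * (a * b) + (a + b - z0 - w)\<close>, whose last bracket is
        nonnegative.\<close>
      show "N + w / 2 < 2 * p" using N_eq p_eq zws am_gm \<theta>ab prod by linarith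
    qed (use N w in auto)
    finally have "w * N < 2 * p\<^sup>2" by (simp add: power2_eq_square mult.commute)
    then show ?thesis using p by (simp add: Q_eq field_simps)
  qed
  have zwQ: "- (z + w) * Q \<le> 2"
  proof -
    define y where "y = N + (a + b - z0) / 2"
    have y_eq: "2 * y = 2 * N + a + b - z0" by (simp add: y_def)
    \<comment> \<open>Here \<open>- (z + w)\<close> is \<open>a + b - z0 - 2 * w\<close>; dropping
      \<open>2 * w\<close> relies on \<open>w \<ge> 0\<close>.\<close>
    have "- (z + w) * (2 * N) \<le> (a + b - z0) * (2 * N)"
      using w N by (intro mult_right_mono) (auto simp: z_def)
    also have "\<dots> = (a + b - z0) * (2 * y - (a + b - z0))" by (simp add: y_def field_simps)
    also have "\<dots> \<le> y\<^sup>2" by (rule mult_twice_diff_le_square)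
    also have "\<dots> \<le> (2 * p)\<^sup>2"
    proof (rule power_mono)
      \<comment> \<open>The difference \<open>4 * p - 2 * y\<close> is exactly
        \<open>2 + 2 * \<theta>\<^sup>2 * (a * b)\<close>.\<close>
      show "y \<le> 2 * p" using y_eq N_eq p_eq \<theta>ab prod by linarith
      show "0 \<le> y" using y_eq N zws am_gm w by linarith
    qed
    finally have "- (z + w) * N \<le> 2 * p\<^sup>2" by (simp add: power2_eq_square algebra_simps)
    then show ?thesis using p by (simp add: Q_eq field_simps)
  qed
  have "z * Q \<le> 0" using z Q by (simp add: mult_nonpos_nonneg)
  \<comment> \<open>The upper bound is \<open>z * Q \<le> 0\<close>, the lower one is
    \<open>- (z + w) * Q \<le> 2\<close>.\<close>
  then have "\<bar>1 + (z + w / 2) * Q\<bar> \<le> 1 + w / 2 * Q"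
    using zwQ by (simp add: abs_le_iff algebra_simps)
  moreover have "\<bar>w / 2 * Q\<bar> < 1" using wQ w Q by simp
  ultimately have "power_bounded
      (companion_matrix (of_real (1 + (z + w / 2) * Q)) (of_real (- (w / 2 * Q))))"
    by (intro power_bounded_companion_real)
  then show ?thesis
    using recurrence_stable_real[of \<theta> a b w z0] \<theta> ab by (simp add: Q_def z_def)
qed

section \<open>Necessity of the lower bound on \<theta>\<close>

lemma ge_critical_if_quadratic_nonneg:
  fixes \<theta> :: real
  assumes "\<theta> \<ge> 1/3" and "16 * \<theta>\<^sup>2 - 18 * \<theta> + 3 \<ge> 0"
  shows "\<theta> \<ge> (9 + sqrt 33) / 16"
proof -
  have "sqrt 33 \<le> \<bar>16 * \<theta> - 9\<bar>"
    using assms(2) by (intro real_le_lsqrt) (simp_all add: power2_eq_square algebra_simps)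
  \<comment> \<open>The smaller root (9 - sqrt 33)/16 is thus below 1/4, so \<theta> \<ge> 1/3
    excludes the lower branch.\<close>
  moreover have "sqrt 33 > 5" by (rule real_less_rsqrt) simp
  ultimately show ?thesis using assms(1) by (auto simp: abs_if field_simps split: if_splits)
qed

lemma critical_le_if_stable:
  fixes \<theta> :: real
  assumes \<theta>: "\<theta> > 0"
    and stable: "\<And>w z0 z1 z2 :: real.
      condition_star (of_real w) (of_real z0) (of_real z1) (of_real z2) \<Longrightarrow>
      recurrence_stable \<theta> (of_real w) (of_real z0) (of_real z1) (of_real z2)"
  shows "\<theta> \<ge> (9 + sqrt 33) / 16"
proof (rule ge_critical_if_quadratic_nonneg)
  \<comment> \<open>This choice makes both factors of p equal to 2, so the denominator of
    \<open>mcs_factor\<close> is 16.\<close>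
  define a where "a = 1 / \<theta>"
  have a: "a > 0" and \<theta>a: "\<theta> * a = 1" using \<theta> by (simp_all add: a_def)
  have factor: "mcs_factor \<theta> z0 a a = (6 - a + z0 / 2) / 16" for z0
  proof -
    have "\<theta>\<^sup>2 * (a * a) = 1" by (metis \<theta>a one_power2 power2_eq_square power_mult_distrib)
    then have "mcs_numerator \<theta> z0 a a = 6 - a + z0 / 2"
      using \<theta>a by (simp add: mcs_numerator_def algebra_simps)
    then show ?thesis by (simp add: mcs_factor_def \<theta>a)
  qed
  have bound: "\<bar>1 + (w + z0 - a - a + w / 2) * mcs_factor \<theta> z0 a a\<bar> \<le> 1 + w / 2 * mcs_factor \<theta> z0 a a"
    if "\<bar>z0\<bar> + \<bar>w\<bar> \<le> 2 * a" for w z0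
  proof (rule power_bounded_companion_realD)
    have "condition_star (of_real w) (of_real z0) (of_real (- a)) (of_real (- a))"
      using that a unfolding condition_star_real by simp
    from stable[OF this] show "power_bounded (companion_matrix
        (of_real (1 + (w + z0 - a - a + w / 2) * mcs_factor \<theta> z0 a a))
        (of_real (- (w / 2 * mcs_factor \<theta> z0 a a))))"
      using recurrence_stable_real[of \<theta> a a w z0] \<theta> a by simp
  qed
  have "a \<le> 3"
  proof -
    \<comment> \<open>With \<open>w = 0\<close> the upper half of \<open>bound\<close> reads
      \<open>z * Q \<le> 0\<close>, where \<open>z = - 4 * a\<close>.\<close>
    have "- (4 * a) * ((6 - 2 * a) / 16) \<le> 0"
      using bound[of "- 2 * a" 0] a by (simp add: factor)
    then show ?thesis using a by (simp add: zero_le_mult_iff)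
  qed
  then show "\<theta> \<ge> 1/3" using \<theta> by (simp add: a_def field_simps)
  \<comment> \<open>For \<open>w = - 2 * a\<close>, \<open>z0 = 0\<close> one has
    \<open>z + w = - 6 * a\<close>, and the lower half of \<open>bound\<close> applies. Multiplying
    by \<open>\<theta>\<^sup>2\<close> then clears \<open>a\<close> and leaves the
    quadratic.\<close>
  have "6 * a * ((6 - a) / 16) \<le> 2"
    using bound[of 0 "- 2 * a"] a by (simp add: factor abs_le_iff field_simps)
  then have "(6 * a * ((6 - a) / 16)) * \<theta>\<^sup>2 \<le> 2 * \<theta>\<^sup>2"
    by (rule mult_right_mono) simp
  moreover have "(6 * a * ((6 - a) / 16)) * \<theta>\<^sup>2 = 6 * ((6 * \<theta> - 1) / 16)"
    using \<theta> by (simp add: a_def field_simps power2_eq_square)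
  ultimately show "16 * \<theta>\<^sup>2 - 18 * \<theta> + 3 \<ge> 0"
    by (simp add: field_simps)
qed

theorem theorem4:
  fixes \<theta> :: real
  assumes "\<theta> > 0"
  shows "(\<theta> \<ge> 1/3 \<longrightarrow>
            (\<forall>w0 z0 z1 z2 :: real.
               condition_star (of_real w0) (of_real z0) (of_real z1) (of_real z2) \<and> w0 \<ge> 0 \<longrightarrow>
               recurrence_stable \<theta> (of_real w0) (of_real z0) (of_real z1) (of_real z2)))
       \<and> ((\<forall>w0 z0 z1 z2 :: real.
               condition_star (of_real w0) (of_real z0) (of_real z1) (of_real z2) \<longrightarrow>
               recurrence_stable \<theta> (of_real w0) (of_real z0) (of_real z1) (of_real z2))
            \<longrightarrow> \<theta> \<ge> (9 + sqrt 33) / 16)"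
proof (intro conjI impI allI)
  fix w0 z0 z1 z2 :: real
  assume "\<theta> \<ge> 1/3"
    and "condition_star (of_real w0) (of_real z0) (of_real z1) (of_real z2) \<and> w0 \<ge> 0"
  then show "recurrence_stable \<theta> (of_real w0) (of_real z0) (of_real z1) (of_real z2)"
    using recurrence_stable_if_ge_third[of \<theta> w0 "- z1" "- z2" z0]
      condition_star_real[of w0 z0 "- z1" "- z2"] by simp
next
  assume "\<forall>w0 z0 z1 z2 :: real.
               condition_star (of_real w0) (of_real z0) (of_real z1) (of_real z2) \<longrightarrow>
               recurrence_stable \<theta> (of_real w0) (of_real z0) (of_real z1) (of_real z2)"
  then show "\<theta> \<ge> (9 + sqrt 33) / 16"
    using critical_le_if_stable[OF assms] by blast
qed

end
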